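(* For all $p,q\in\mathbb{N}_0$ and all integers $n\ge 1$, \[ \sum_{k=1}^n\binom{p+k}{p}\binom{q+n-k}{q}\,k\,H_{p+k}H_{q+n-k} =(p+1)\binom{p+q+n+1}{n-1}\Big\{\big(H_{p+q+2}^{\langle 2\rangle}-H_{p+q+n+1}^{\langle 2\rangle}\big)+\big(H_{p+1}-H_{p+q+2}+H_{p+q+n+1}\big)\big(H_q-H_{p+q+2}+H_{p+q+n+1}\big)\Big\}. \]
   Context: $\mathbb{N}_0$ denotes the set of nonnegative integers and $\mathbb{N}$ the set of positive integers. For $l\in\mathbb{N}$ the generalized harmonic numbers are $H_0^{\langle l\rangle}=0$ and $H_n^{\langle l\rangle}=\sum_{k=1}^n\frac{1}{k^l}$ for $n\ge 1$. The classical harmonic numbers are $H_n=H_n^{\langle 1\rangle}$, so $H_0=0$ and $H_n=\sum_{k=1}^n\frac1k$. *)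

theory Defs
  imports "HOL-Analysis.Harmonic_Numbers"
begin

definition gen_harm :: "nat \<Rightarrow> nat \<Rightarrow> real" where
  "gen_harm l n = (\<Sum>k=1..n. 1 / real k ^ l)"

lemma gen_harm_0: "gen_harm l 0 = 0"
  by (simp add: gen_harm_def)

lemma gen_harm_1: "gen_harm 1 n = harm n"
  by (simp add: gen_harm_def harm_def inverse_eq_divide)

end

theory Submission
  imports Defs "HOL-Computational_Algebra.Formal_Power_Series"
begin

text \<open>
  Absorbing the factor \<open>k\<close> by \<open>k * (p+k choose p) = (p+1) * (p+k choose (p+1))\<close> and shifting the
  summation index turns the left-hand side into \<open>p + 1\<close> times the coefficient of \<open>X^(n-1)\<close> in a
  product \<open>Q_a * Q_b\<close>, where \<open>a = p + 1\<close>, \<open>b = q\<close> and \<open>Q_c\<close> has the coefficients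
  \<open>(c+m choose m) * H_(c+m)\<close>.

  The product is found from a differential equation. The operator \<open>\<theta> f = (1 - X) *
  f'\<close> is a derivation, and if \<open>F_c(h)\<close> has the coefficients \<open>(c+m choose
  m) * h(c+m)\<close>, then \<open>\<theta> F_c(h) = (c+1) * F_c(h) + F_c(g)\<close> with
  \<open>g(n) = (n+1) * (h(n+1) - h(n))\<close> (lemma \<open>theta_binom_series\<close>). Write
  \<open>H2\<close> for the harmonic numbers of order two. The passage from \<open>h\<close> to
  \<open>g\<close> sends \<open>1\<close> to \<open>0\<close>, \<open>H\<close> to
  \<open>1\<close>, and \<open>H\<^sup>2 - H2\<close> to \<open>2 * H\<close>. By the product
  rule, \<open>P_a * P_b\<close>, \<open>P_a * Q_b\<close> and \<open>Q_a * Q_b\<close>, where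
  \<open>P_c = F_c(1)\<close>, satisfy equations with the same leading term \<open>(c+1) *
  f\<close> for \<open>c = a + b + 1\<close>, and the inhomogeneity of each is made of the
  products before it. Such an equation determines \<open>f\<close> from its constant coefficient
  (lemma \<open>theta_unique\<close>), which makes each product a combination of
  \<open>F_c(1)\<close>, \<open>F_c(H)\<close> and \<open>F_c(H\<^sup>2 - H2)\<close>. Reading off
  coefficients gives the right-hand side.
\<close>

unbundle no vec_syntax
unbundle fps_syntax

section \<open>The derivation \<open>(1 - X) d/dX\<close>\<close>

definition theta :: "real fps \<Rightarrow> real fps" where
  "theta f = (1 - fps_X) * fps_deriv f"

lemma theta_add: "theta (f + g) = theta f + theta g"
  by (simp add: theta_def algebra_simps)

lemma theta_const_mult: "theta (fps_const c * f) = fps_const c * theta f"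
  by (simp add: theta_def algebra_simps)

lemma theta_mult: "theta (f * g) = theta f * g + f * theta g"
  by (simp add: theta_def algebra_simps)

lemma theta_nth: "theta f $ n = real (n + 1) * f $ (n + 1) - real n * f $ n"
  by (cases n) (simp_all add: theta_def left_diff_distrib)

text \<open>
  Comparing coefficients, the equation is a first-order recurrence in which the coefficient
  \<open>f $ (n + 1)\<close> carries the nonzero factor \<open>n + 1\<close>.
\<close>
lemma theta_unique:
  assumes f: "theta f = fps_const c * f + r" and g: "theta g = fps_const c * g + r"
    and init: "f $ 0 = g $ 0"
  shows "f = g"
proof (rule fps_ext)
  fix n
  show "f $ n = g $ n"
  proof (induction n)
    case 0
    show ?case by (fact init)
  next
    case (Suc n)
    have "real (n + 1) * f $ (n + 1) = (c + real n) * f $ n + r $ n"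
      using theta_nth[of f n] by (simp add: f algebra_simps)
    moreover have "real (n + 1) * g $ (n + 1) = (c + real n) * g $ n + r $ n"
      using theta_nth[of g n] by (simp add: g algebra_simps)
    ultimately have "real (n + 1) * f $ (n + 1) = real (n + 1) * g $ (n + 1)"
      using Suc.IH by simp
    then show ?case by (simp del: of_nat_add of_nat_Suc)
  qed
qed

section \<open>Binomial series with weights\<close>

definition binom_series :: "nat \<Rightarrow> (nat \<Rightarrow> real) \<Rightarrow> real fps" where
  "binom_series c h = Abs_fps (\<lambda>m. real ((c + m) choose m) * h (c + m))"

lemma binom_series_nth: "binom_series c h $ m = real ((c + m) choose m) * h (c + m)"
  by (simp add: binom_series_def)

lemma binom_series_0: "binom_series c (\<lambda>_. 0) = 0"
  by (simp add: fps_eq_iff binom_series_nth)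

text \<open>
  The binomial coefficients obey \<open>(m+1) * (c+m+1 choose (m+1)) = (c+m+1) * (c+m choose m)\<close>.
  Replacing \<open>h(c+m+1)\<close> by \<open>h(c+m)\<close> plus a difference splits this into the homogeneous term and the
  weighted difference.
\<close>
lemma theta_binom_series:
  "theta (binom_series c h) = fps_const (real (c + 1)) * binom_series c h
     + binom_series c (\<lambda>n. real (n + 1) * (h (n + 1) - h n))"
proof (rule fps_ext)
  fix m
  have "Suc m * (Suc (c + m) choose Suc m) = Suc (c + m) * ((c + m) choose m)"
    using Suc_times_binomial_eq[of "c + m" m] by (simp only: mult.commute)
  then have absorb: "real (m + 1) * real ((c + (m + 1)) choose (m + 1))
      = real (c + m + 1) * real ((c + m) choose m)"
    by (metis Suc_eq_plus1 add.assoc of_nat_mult)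
  have "theta (binom_series c h) $ m
      = (real (m + 1) * real ((c + (m + 1)) choose (m + 1))) * h (c + (m + 1))
        - real m * (real ((c + m) choose m) * h (c + m))"
    by (simp add: theta_nth binom_series_nth)
  also have "\<dots> = (real (c + m + 1) * real ((c + m) choose m)) * h (c + m + 1)
        - real m * (real ((c + m) choose m) * h (c + m))"
    by (simp only: absorb) (simp add: add.assoc)
  finally show "theta (binom_series c h) $ m = (fps_const (real (c + 1)) * binom_series c h
      + binom_series c (\<lambda>n. real (n + 1) * (h (n + 1) - h n))) $ m"
    by (simp add: binom_series_nth algebra_simps)
qed

text \<open>
  The weights that occur form a chain under \<open>h(n) \<mapsto> (n+1) * (h(n+1) - h(n))\<close>. The term
  \<open>H2\<close> in the last one is there to cancel the square \<open>1/(n+1)\<^sup>2\<close> in the increment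
  of \<open>H\<^sup>2\<close>.
\<close>
abbreviation P :: "nat \<Rightarrow> real fps" where
  "P c \<equiv> binom_series c (\<lambda>_. 1)"

abbreviation Q :: "nat \<Rightarrow> real fps" where
  "Q c \<equiv> binom_series c harm"

abbreviation R :: "nat \<Rightarrow> real fps" where
  "R c \<equiv> binom_series c (\<lambda>n. harm n ^ 2 - gen_harm 2 n)"

lemma theta_P: "theta (P c) = fps_const (real (c + 1)) * P c"
  by (simp add: theta_binom_series binom_series_0)

lemma theta_Q: "theta (Q c) = fps_const (real (c + 1)) * Q c + P c"
proof -
  have "real (n + 1) * (harm (n + 1) - harm n) = 1" for n
    by (simp add: harm_Suc field_simps)
  then show ?thesis by (simp only: theta_binom_series)
qed

lemma theta_R: "theta (R c) = fps_const (real (c + 1)) * R c + fps_const 2 * Q c"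
proof -
  have weight: "real (n + 1) * ((harm (n + 1) ^ 2 - gen_harm 2 (n + 1))
      - (harm n ^ 2 - gen_harm 2 n)) = 2 * harm n" for n
  proof -
    have H: "harm (n + 1) = harm n + 1 / real (n + 1)"
      by (simp add: harm_Suc inverse_eq_divide)
    have "gen_harm 2 (n + 1) = gen_harm 2 n + (1 / real (n + 1)) ^ 2"
      by (simp add: gen_harm_def power_one_over)
    then have "(harm (n + 1) ^ 2 - gen_harm 2 (n + 1)) - (harm n ^ 2 - gen_harm 2 n)
        = 2 * harm n * (1 / real (n + 1))"
      unfolding H by algebra
    then show ?thesis by simp
  qed
  show ?thesis
    by (simp only: theta_binom_series weight)
       (simp add: fps_eq_iff binom_series_nth)
qed

section \<open>Products of the series\<close>

text \<open>
  By the product rule, the constants \<open>a + 1\<close> and \<open>b + 1\<close> of two factors add up to the constant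
  \<open>c + 1\<close> of \<open>c = a + b + 1\<close>, which is why the products stay within the series of index \<open>c\<close>.
\<close>
lemma const_split:
  "fps_const (real (a + b + 2)) = fps_const (real (a + 1)) + fps_const (real (b + 1))"
  by simp

lemma P_mult_P: "P a * P b = P (a + b + 1)"
proof (rule theta_unique[where c = "real (a + b + 2)" and r = 0])
  show "theta (P a * P b) = fps_const (real (a + b + 2)) * (P a * P b) + 0"
    unfolding theta_mult theta_P const_split by (simp only: algebra_simps add_0_left)
  show "theta (P (a + b + 1)) = fps_const (real (a + b + 2)) * P (a + b + 1) + 0"
    by (simp add: theta_P add.commute)
qed (simp add: binom_series_nth)

lemma P_mult_Q:
  "P a * Q b = Q (a + b + 1) + fps_const (harm b - harm (a + b + 1)) * P (a + b + 1)"
proof (rule theta_unique[where c = "real (a + b + 2)" and r = "P (a + b + 1)"])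
  have "theta (P a * Q b) = fps_const (real (a + b + 2)) * (P a * Q b) + P a * P b"
    unfolding theta_mult theta_P theta_Q const_split by (simp only: algebra_simps)
  then show "theta (P a * Q b) = fps_const (real (a + b + 2)) * (P a * Q b) + P (a + b + 1)"
    by (simp only: P_mult_P)
  have c: "real (a + b + 1 + 1) = real (a + b + 2)"
    by simp
  show "theta (Q (a + b + 1) + fps_const (harm b - harm (a + b + 1)) * P (a + b + 1))
      = fps_const (real (a + b + 2))
          * (Q (a + b + 1) + fps_const (harm b - harm (a + b + 1)) * P (a + b + 1))
        + P (a + b + 1)"
    unfolding theta_add theta_const_mult theta_P theta_Q c
    by (simp only: algebra_simps)
qed (simp add: binom_series_nth)

text \<open>
  The inhomogeneity \<open>P_a * Q_b + Q_a * P_b\<close> is \<open>2 * Q_c + (H_a + H_b - 2 * H_c) * P_c\<close>. The series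
  \<open>R_c\<close> accounts for the first term and a multiple of \<open>Q_c\<close> for the second; the constant
  coefficient \<open>H_a * H_b\<close> fixes the multiple of \<open>P_c\<close>, which solves the homogeneous equation.
\<close>
lemma Q_mult_Q:
  fixes a b :: nat
  defines "c \<equiv> a + b + 1"
  shows "Q a * Q b = R c + fps_const (harm a + harm b - 2 * harm c) * Q c
    + fps_const (gen_harm 2 c + (harm a - harm c) * (harm b - harm c)) * P c"
proof (rule theta_unique[where c = "real (c + 1)"
      and r = "fps_const 2 * Q c + fps_const (harm a + harm b - 2 * harm c) * P c"])
  have c1: "fps_const (real (c + 1)) = fps_const (real (a + 1)) + fps_const (real (b + 1))"
    by (simp add: c_def)
  have "theta (Q a * Q b) = fps_const (real (c + 1)) * (Q a * Q b) + (P a * Q b + P b * Q a)"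
    unfolding theta_mult theta_Q c1 by (simp only: algebra_simps)
  also have "P a * Q b + P b * Q a
      = fps_const 2 * Q c + fps_const (harm a + harm b - 2 * harm c) * P c"
  proof (rule fps_ext)
    fix m
    have ab: "a + b + 1 = c" and ba: "b + a + 1 = c"
      by (simp_all add: c_def)
    show "(P a * Q b + P b * Q a) $ m
        = (fps_const 2 * Q c + fps_const (harm a + harm b - 2 * harm c) * P c) $ m"
      unfolding P_mult_Q ab ba fps_add_nth fps_mult_left_const_nth by (simp add: algebra_simps)
  qed
  finally show "theta (Q a * Q b) = fps_const (real (c + 1)) * (Q a * Q b)
      + (fps_const 2 * Q c + fps_const (harm a + harm b - 2 * harm c) * P c)" .
  show "theta (R c + fps_const (harm a + harm b - 2 * harm c) * Q c
        + fps_const (gen_harm 2 c + (harm a - harm c) * (harm b - harm c)) * P c)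
      = fps_const (real (c + 1)) * (R c + fps_const (harm a + harm b - 2 * harm c) * Q c
        + fps_const (gen_harm 2 c + (harm a - harm c) * (harm b - harm c)) * P c)
      + (fps_const 2 * Q c + fps_const (harm a + harm b - 2 * harm c) * P c)"
    unfolding theta_add theta_const_mult theta_P theta_Q theta_R
    by (simp only: algebra_simps)
qed (simp add: binom_series_nth algebra_simps power2_eq_square)

section \<open>The harmonic number identity\<close>

lemma harmonic_vandermonde:
  "(\<Sum>m=0..N. real ((a + m) choose m) * real ((b + (N - m)) choose (N - m))
       * harm (a + m) * harm (b + (N - m)))
   = real ((a + b + 1 + N) choose N)
     * ((gen_harm 2 (a + b + 1) - gen_harm 2 (a + b + 1 + N))
        + (harm a - harm (a + b + 1) + harm (a + b + 1 + N))
          * (harm b - harm (a + b + 1) + harm (a + b + 1 + N)))"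
proof -
  have "(\<Sum>m=0..N. real ((a + m) choose m) * real ((b + (N - m)) choose (N - m))
       * harm (a + m) * harm (b + (N - m))) = (Q a * Q b) $ N"
    by (simp add: fps_mult_nth binom_series_nth mult_ac)
  then show ?thesis
    by (simp only: Q_mult_Q fps_add_nth fps_mult_left_const_nth binom_series_nth)
       (simp add: algebra_simps power2_eq_square)
qed

lemma times_binomial_absorb:
  "real ((p + Suc m) choose p) * real (Suc m) = real (p + 1) * real ((p + 1 + m) choose m)"
proof -
  have "(p + Suc m) choose p = Suc (p + m) choose Suc m"
    using binomial_symmetric[of p "p + Suc m"] by simp
  then have "((p + Suc m) choose p) * Suc m = Suc (p + m) * ((p + m) choose m)"
    using Suc_times_binomial_eq[of "p + m" m] by (simp add: mult.commute)
  also have "(p + m) choose m = (p + m) choose p"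
    using binomial_symmetric[of p "p + m"] by simp
  also have "Suc (p + m) * ((p + m) choose p) = Suc p * (Suc (p + m) choose Suc p)"
    using Suc_times_binomial_eq[of "p + m" p] by (simp add: mult.commute)
  also have "Suc (p + m) choose Suc p = (p + 1 + m) choose m"
    using binomial_symmetric[of "Suc p" "Suc (p + m)"] by simp
  finally show ?thesis
    by (metis Suc_eq_plus1 of_nat_mult)
qed

theorem theorem2:
  fixes p q n :: nat
  assumes "n \<ge> 1"
  shows "(\<Sum>k=1..n. real ((p + k) choose p) * real ((q + n - k) choose q) * real k
            * harm (p + k) * harm (q + n - k))
         = real (p + 1) * real ((p + q + n + 1) choose (n - 1))
           * ((gen_harm 2 (p + q + 2) - gen_harm 2 (p + q + n + 1))
              + (harm (p + 1) - harm (p + q + 2) + harm (p + q + n + 1))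
                * (harm q - harm (p + q + 2) + harm (p + q + n + 1)))"
proof -
  from assms obtain N where n: "n = Suc N"
    by (cases n) auto
  have summand: "real ((p + Suc m) choose p) * real ((q + n - Suc m) choose q) * real (Suc m)
        * harm (p + Suc m) * harm (q + n - Suc m)
      = real (p + 1) * (real ((p + 1 + m) choose m) * real ((q + (N - m)) choose (N - m))
        * harm (p + 1 + m) * harm (q + (N - m)))" if "m \<le> N" for m
  proof -
    have idx: "q + n - Suc m = q + (N - m)"
      using that n by simp
    have sym: "(q + (N - m)) choose q = (q + (N - m)) choose (N - m)"
      using binomial_symmetric[of q "q + (N - m)"] by simp
    have "real ((p + Suc m) choose p) * real ((q + n - Suc m) choose q) * real (Suc m)
          * harm (p + Suc m) * harm (q + n - Suc m)
        = (real ((p + Suc m) choose p) * real (Suc m)) * real ((q + (N - m)) choose (N - m))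
          * harm (p + 1 + m) * harm (q + (N - m))"
      unfolding idx sym by (simp add: mult_ac)
    then show ?thesis
      unfolding times_binomial_absorb by (simp only: mult.assoc)
  qed
  have "(\<Sum>k=1..n. real ((p + k) choose p) * real ((q + n - k) choose q) * real k
            * harm (p + k) * harm (q + n - k))
      = (\<Sum>m=0..N. real ((p + Suc m) choose p) * real ((q + n - Suc m) choose q) * real (Suc m)
            * harm (p + Suc m) * harm (q + n - Suc m))"
    unfolding n One_nat_def by (rule sum.shift_bounds_cl_Suc_ivl)
  also have "\<dots> = real (p + 1) * (\<Sum>m=0..N. real ((p + 1 + m) choose m)
        * real ((q + (N - m)) choose (N - m)) * harm (p + 1 + m) * harm (q + (N - m)))"
    unfolding sum_distrib_left by (intro sum.cong refl summand) simp
  finally show ?thesis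
    unfolding harmonic_vandermonde using n by (simp add: add_ac)
qed

end
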